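(* Let $G$ be a distance-regular graph on $n$ vertices with diameter $d=4$, valency $k$, intersection numbers $a_1$ and $b_1$, and distinct adjacency eigenvalues $\lambda_0(=k)>\lambda_1>\lambda_2>\lambda_3>\lambda_4$. Then $G$ is strongly distance-regular if and only if $$(1+\lambda_1)(1+\lambda_3)=(1+\lambda_2)(1+\lambda_4)=-b_1.$$ Moreover, in this case (i.e., when $G$ is strongly distance-regular), $G$ is antipodal if and only if either $\lambda_1\lambda_3=-k$ or $\lambda_1+\lambda_3=a_1$.
   Context: A connected graph $G$ of diameter $d$ is distance-regular if for any two vertices $u,v$ at distance $i$, the numbers $c_i$, $a_i$, $b_i$ of neighbours of $v$ at distance $i-1$, $i$, $i+1$ from $u$ depend only on $i$; here $k=b_0$ is the valency, $c_1=1$, and $a_1=k-b_1-1$. A distance-regular graph of diameter $d$ has exactly $d+1$ distinct adjacency eigenvalues. The distance-$d$ graph $G_d$ of $G$ has the same vertex set as $G$, with two vertices adjacent iff they are at distance $d$ in $G$. $G$ is strongly distance-regular if it is distance-regular and $G_d$ is strongly regular. $G$ is antipodal if $G_d$ is a disjoint union of complete graphs (equivalently, being equal or at distance $d$ is an equivalence relation on the vertices). *)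

theory Defs
  imports
    "Graph_Theory.Graph_Theory"
    "Jordan_Normal_Form.Char_Poly"
    "HOL-Library.Disjoint_Sets"
begin

text \<open>
  A finite simple graph is a symmetric digraph without loops and parallel arcs
  (\<^locale>\<open>pair_graph\<close>); an undirected edge is a pair of opposite arcs.
\<close>

definition neighbours :: "'a pair_pre_digraph \<Rightarrow> 'a \<Rightarrow> 'a set" where
  "neighbours G v = {w. (v, w) \<in> parcs G}"

text \<open>Meaningful only if a walk from \<open>u\<close> to \<open>v\<close> exists; it is used for connected graphs.\<close>

definition gdist :: "'a pair_pre_digraph \<Rightarrow> 'a \<Rightarrow> 'a \<Rightarrow> nat" where
  "gdist G u v = (LEAST m. \<exists>p. pre_digraph.awalk (with_proj G) u p v \<and> length p = m)"

lemma gdist_eq_shortest_path: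
  assumes "pair_graph G" and "u \<rightarrow>\<^sup>*\<^bsub>with_proj G\<^esub> v"
  shows "wf_digraph.\<mu> (with_proj G) (\<lambda>_. 1) u v = ereal (real (gdist G u v))"
proof -
  interpret pair_graph G by fact
  let ?P = "\<lambda>m. \<exists>p. awalk u p v \<and> length p = m"
  have cost: "awalk_cost (\<lambda>_. 1) p = real (length p)" for p :: "('a \<times> 'a) list"
    by (induct p) auto
  obtain p where "awalk u p v"
    using assms(2) reachable_awalk by auto
  then have "?P (length p)" by blast
  then have "?P (LEAST m. ?P m)" by (rule LeastI)
  then obtain q where q: "awalk u q v" "length q = gdist G u v"
    unfolding gdist_def by blast
  have least: "gdist G u v \<le> length r" if "awalk u r v" for r
    unfolding gdist_def by (rule Least_le) (use that in blast)
  show ?thesis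
    unfolding \<mu>_def cost
  proof (rule INF_eqI)
    show "ereal (real (gdist G u v)) \<le> ereal (real (length r))" if "r \<in> {p. awalk u p v}" for r
      using least that by simp
    show "y \<le> ereal (real (gdist G u v))"
      if "\<And>r. r \<in> {p. awalk u p v} \<Longrightarrow> y \<le> ereal (real (length r))" for y
      using that[of q] q by simp
  qed
qed

definition graph_diameter :: "'a pair_pre_digraph \<Rightarrow> nat" where
  "graph_diameter G = Max {gdist G u v | u v. u \<in> pverts G \<and> v \<in> pverts G}"

text \<open>
  The number \<open>c i\<close> counts neighbours at distance \<open>i - 1\<close>; writing this as
  \<open>gdist G u w + 1 = i\<close> avoids truncated subtraction and gives \<open>c 0 = 0\<close>.
  Values of \<open>c\<close>, \<open>a\<close>, \<open>b\<close> beyond the diameter are unconstrained.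
\<close>

definition intersection_numbers ::
    "'a pair_pre_digraph \<Rightarrow> (nat \<Rightarrow> nat) \<Rightarrow> (nat \<Rightarrow> nat) \<Rightarrow> (nat \<Rightarrow> nat) \<Rightarrow> bool" where
  "intersection_numbers G c a b \<longleftrightarrow>
     (\<forall>i. \<forall>u\<in>pverts G. \<forall>v\<in>pverts G. gdist G u v = i \<longrightarrow>
        card {w \<in> neighbours G v. gdist G u w + 1 = i} = c i \<and>
        card {w \<in> neighbours G v. gdist G u w = i} = a i \<and>
        card {w \<in> neighbours G v. gdist G u w = i + 1} = b i)"

definition distance_regular :: "'a pair_pre_digraph \<Rightarrow> bool" where
  "distance_regular G \<longleftrightarrow>
     pair_graph G \<and> Digraph_Component.connected (with_proj G) \<and>
     (\<exists>c a b. intersection_numbers G c a b)"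

definition distance_graph :: "'a pair_pre_digraph \<Rightarrow> nat \<Rightarrow> 'a pair_pre_digraph" where
  "distance_graph G i =
     \<lparr> pverts = pverts G,
       parcs = {(u, v). u \<in> pverts G \<and> v \<in> pverts G \<and> gdist G u v = i} \<rparr>"

text \<open>
  Complete and edgeless graphs are excluded, but connectedness is not required: a disjoint
  union of at least two complete graphs of the same order \<open>\<ge> 2\<close> is strongly regular (with
  \<open>m = 0\<close>), so antipodal distance-regular graphs of diameter at least two qualify as strongly
  distance-regular.
\<close>

definition strongly_regular :: "'a pair_pre_digraph \<Rightarrow> bool" where
  "strongly_regular H \<longleftrightarrow>
     pair_graph H \<and> parcs H \<noteq> {} \<and>
     (\<exists>u\<in>pverts H. \<exists>v\<in>pverts H. u \<noteq> v \<and> (u, v) \<notin> parcs H) \<and>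
     (\<exists>r l m. (\<forall>v\<in>pverts H. card (neighbours H v) = r) \<and>
        (\<forall>u\<in>pverts H. \<forall>v\<in>pverts H. (u, v) \<in> parcs H \<longrightarrow>
           card (neighbours H u \<inter> neighbours H v) = l) \<and>
        (\<forall>u\<in>pverts H. \<forall>v\<in>pverts H. u \<noteq> v \<and> (u, v) \<notin> parcs H \<longrightarrow>
           card (neighbours H u \<inter> neighbours H v) = m))"

definition strongly_distance_regular :: "'a pair_pre_digraph \<Rightarrow> bool" where
  "strongly_distance_regular G \<longleftrightarrow>
     distance_regular G \<and> strongly_regular (distance_graph G (graph_diameter G))"

definition disjoint_union_of_complete_graphs :: "'a pair_pre_digraph \<Rightarrow> bool" where
  "disjoint_union_of_complete_graphs H \<longleftrightarrow>
     (\<exists>P. partition_on (pverts H) P \<and>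
        parcs H = (\<Union>B\<in>P. {(u, v). u \<in> B \<and> v \<in> B \<and> u \<noteq> v}))"

definition antipodal :: "'a pair_pre_digraph \<Rightarrow> bool" where
  "antipodal G \<longleftrightarrow> disjoint_union_of_complete_graphs (distance_graph G (graph_diameter G))"

definition adjacency_matrix :: "'a pair_pre_digraph \<Rightarrow> 'a list \<Rightarrow> real mat" where
  "adjacency_matrix G vs =
     mat (length vs) (length vs) (\<lambda>(i, j). if (vs ! i, vs ! j) \<in> parcs G then 1 else 0)"

text \<open>
  The matrix depends on the enumeration \<open>vs\<close> of the vertices only up to simultaneous
  permutation of rows and columns, so its eigenvalues do not depend on \<open>vs\<close>.
\<close>

definition adjacency_eigenvalues :: "'a pair_pre_digraph \<Rightarrow> real set" where
  "adjacency_eigenvalues G =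
     {\<theta>. \<exists>vs. distinct vs \<and> set vs = pverts G \<and> eigenvalue (adjacency_matrix G vs) \<theta>}"

end

theory Submission
  imports Defs
begin

text \<open>
  Let \<open>A\<^sub>i\<close> be the adjacency matrix of the distance-\<open>i\<close> graph. The three-term recurrence for
  \<open>A A\<^sub>i\<close> gives \<open>A\<^sub>4\<^sup>2\<close> as an explicit combination of the \<open>A\<^sub>h\<close>, and \<open>G\<^sub>4\<close> is strongly regular iff
  \<open>A\<^sub>1\<close>, \<open>A\<^sub>2\<close>, \<open>A\<^sub>3\<close> have the same coefficient there, which amounts to
  \<open>b\<^sub>3 = 1 + a\<^sub>4\<close> and \<open>b\<^sub>3 c\<^sub>3 = b\<^sub>1\<close>.
  On the other hand, for each of the four eigenvalues \<open>\<theta> \<noteq> k\<close> the number \<open>y = 1 + \<theta>\<close> is a root of a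
  monic quartic in the intersection numbers. If the two identities hold, this quartic is, up to the
  factor \<open>y\<^sup>2\<close>, a quadratic in \<open>y - b\<^sub>1 / y\<close>, so its four roots fall into two pairs with product
  \<open>- b\<^sub>1\<close>, and their order determines the pairs. Conversely, Vieta's formulas recover the two
  identities from the pairing. Under these identities \<open>G\<close> is antipodal iff \<open>a\<^sub>4 = 0\<close>, iff \<open>c\<^sub>3 = b\<^sub>1\<close>,
  which is exactly the case in which the quadratic has the root \<open>a\<^sub>1 + 2 = y\<^sub>1 + y\<^sub>3\<close>.
\<close>

section \<open>The quartic of the nontrivial eigenvalues\<close>

text \<open>The quartic and the product of the linear factors are both monic, so their difference
  has degree at most 3; having four distinct roots, it vanishes. The coefficients are grouped by the
  pairs \<open>x1\<close>, \<open>x3\<close> and \<open>x2\<close>, \<open>x4\<close>, ready for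
  prescribed values of the two products.\<close>

lemma monic_quartic_roots:
  fixes x1 x2 x3 x4 q0 q1 q2 q3 :: "'a :: idom"
  assumes "distinct [x1, x2, x3, x4]"
    and "\<And>x. x \<in> {x1, x2, x3, x4} \<Longrightarrow> x^4 + q3 * x^3 + q2 * x^2 + q1 * x + q0 = 0"
  shows "q3 = - (x1 + x2 + x3 + x4)"
    and "q1 = - (x1 * x3 * (x2 + x4) + x2 * x4 * (x1 + x3))"
    and "q0 = x1 * x3 * (x2 * x4)"
proof -
  let ?p = "[:q0, q1, q2, q3, 1:]"
  let ?r = "[:- x1, 1:] * [:- x2, 1:] * [:- x3, 1:] * [:- x4, 1:]"
  have eq: "?p = ?r"
  proof (rule ccontr)
    assume "?p \<noteq> ?r"
    then have ne: "?p - ?r \<noteq> 0" by simp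
    have "?p - ?r = [:q0 - x1 * x3 * (x2 * x4),
        q1 + (x1 * x3 * (x2 + x4) + x2 * x4 * (x1 + x3)),
        q2 - (x1 * x2 + x1 * x3 + x1 * x4 + x2 * x3 + x2 * x4 + x3 * x4),
        q3 + (x1 + x2 + x3 + x4):]"
      by (simp add: algebra_simps)
    then have deg: "degree (?p - ?r) \<le> 3"
      by (simp add: degree_pCons_eq_if)
    have "{x1, x2, x3, x4} \<subseteq> {x. poly (?p - ?r) x = 0}"
      using assms(2)[of x1] assms(2)[of x2] assms(2)[of x3] assms(2)[of x4]
      by (auto simp: algebra_simps power_numeral_reduce)
    then have "card {x1, x2, x3, x4} \<le> card {x. poly (?p - ?r) x = 0}"
      using poly_roots_finite[OF ne] by (rule card_mono[rotated])
    also have "\<dots> \<le> degree (?p - ?r)"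
      by (rule card_poly_roots_bound[OF ne])
    finally show False
      using deg assms(1) by simp
  qed
  show "q3 = - (x1 + x2 + x3 + x4)"
    using arg_cong[OF eq, of "\<lambda>p. coeff p 3"] by (simp add: algebra_simps numeral_3_eq_3)
  show "q1 = - (x1 * x3 * (x2 + x4) + x2 * x4 * (x1 + x3))"
    using arg_cong[OF eq, of "\<lambda>p. coeff p 1"] by (simp add: algebra_simps)
  show "q0 = x1 * x3 * (x2 * x4)"
    using arg_cong[OF eq, of "\<lambda>p. coeff p 0"] by (simp add: algebra_simps)
qed

text \<open>
  The characteristic polynomial of the intersection matrix, divided by its factor for the
  eigenvalue \<open>k\<close> and written in the variable \<open>y = 1 + \<theta>\<close>.
\<close>

definition quartic :: "real \<Rightarrow> real \<Rightarrow> real \<Rightarrow> real \<Rightarrow> real \<Rightarrow> real \<Rightarrow> real \<Rightarrow> real \<Rightarrow> real" where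
  "quartic a1 b1 c2 a2 b3 c3 a4 y =
     (y + (b3 - 1 - a4)) *
       (y^3 - (a1 + 2 + (1 + a2 - c3)) * y^2
        + (c2 * c3 + (1 + a2 - c3) * (a1 + 2) - b1 - b1 * c2) * y + b1 * (1 + a2 - c3 + c2))
     - b3 * c3 * (y^2 + (c2 - a1 - 2) * y - b1)"

text \<open>Here \<open>p2\<close>, \<open>p3\<close>, \<open>p4\<close> stand for the eigenvalues
  of the distance matrices on a common eigenvector. The vanishing sum, which says that the all-one
  matrix kills this vector, excludes the factor \<theta> - k; eliminating the \<open>p\<close>'s
  leaves the quartic.\<close>

lemma eigenvalue_quartic:
  fixes \<theta> k a1 a2 a4 b1 b3 c2 c3 p2 p3 p4 :: real
  assumes "k = 1 + a1 + b1"
    and "\<theta> * \<theta> = k + a1 * \<theta> + c2 * p2"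
    and "\<theta> * p2 = b1 * \<theta> + a2 * p2 + c3 * p3"
    and "\<theta> * p4 = b3 * p3 + a4 * p4"
    and "1 + \<theta> + p2 + p3 + p4 = 0"
  shows "quartic a1 b1 c2 a2 b3 c3 a4 (1 + \<theta>) = 0"
proof -
  have p4: "p4 = - (1 + \<theta> + p2 + p3)" using assms(5) by simp
  have p3: "c3 * p3 = (\<theta> - a2) * p2 - b1 * \<theta>" using assms(3) by (simp add: algebra_simps)
  have p2: "c2 * p2 = \<theta> * \<theta> - k - a1 * \<theta>" using assms(2) by simp
  have e: "(\<theta> - a4) * (1 + \<theta> + p2 + p3) + b3 * p3 = 0"
    using assms(4) unfolding p4 by (simp add: algebra_simps)
  have "c2 * c3 * p3 = (\<theta> - a2) * (\<theta> * \<theta> - k - a1 * \<theta>) - c2 * b1 * \<theta>"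
    using p2 p3 by Groebner_Basis.algebra (* unqualified, the method of HOL-Algebra is meant *)
  moreover have "(\<theta> - a4) * (c2 * c3 * (1 + \<theta>) + c3 * (c2 * p2) + c2 * c3 * p3) + b3 * (c2 * c3 * p3) = 0"
    using e by Groebner_Basis.algebra
  ultimately show ?thesis
    unfolding quartic_def p2 assms(1) by Groebner_Basis.algebra
qed

lemma quartic_monic_form:
  "quartic a1 b1 c2 a2 b3 c3 a4 y = y^4
    + (b3 - 1 - a4 - (a1 + 2 + (1 + a2 - c3))) * y^3
    + (c2 * c3 + (1 + a2 - c3) * (a1 + 2) - b1 - b1 * c2
       - (b3 - 1 - a4) * (a1 + 2 + (1 + a2 - c3)) - b3 * c3) * y^2
    + (b1 * (1 + a2 - c3 + c2) + (b3 - 1 - a4) * (c2 * c3 + (1 + a2 - c3) * (a1 + 2) - b1 - b1 * c2)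
       - b3 * c3 * (c2 - a1 - 2)) * y
    + ((b3 - 1 - a4) * b1 * (1 + a2 - c3 + c2) + b3 * c3 * b1)"
  unfolding quartic_def by Groebner_Basis.algebra

text \<open>With both products equal to \<open>- b1\<close>, Vieta's formulas give two equations,
  linear in the defects \<open>b3 - 1 - a4\<close> and \<open>b1 - b3 * c3\<close>, whose only
  solution is zero.\<close>

lemma quartic_paired_roots_imp:
  fixes a1 a2 a4 b1 b2 b3 c2 c3 y1 y2 y3 y4 :: real
  assumes "1 + a1 + b1 = c2 + a2 + b2" "b1 > 0" "b2 > 0" "c2 > 0"
    and "y1 > y2" "y2 > y3" "y3 > y4"
    and Q: "\<And>y. y \<in> {y1, y2, y3, y4} \<Longrightarrow> quartic a1 b1 c2 a2 b3 c3 a4 y = 0"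
    and T: "y1 * y3 = - b1" "y2 * y4 = - b1"
  shows "b3 = 1 + a4" "b3 * c3 = b1"
proof -
  have d: "distinct [y1, y2, y3, y4]" using assms(5-7) by simp
  note V = monic_quartic_roots[OF d Q[unfolded quartic_monic_form], unfolded T]
  define \<delta> where "\<delta> = b3 - 1 - a4"
  define z where "z = 1 + a2 - c3"
  define r2 where "r2 = c2 * c3 + z * (a1 + 2) - b1 - b1 * c2"
  note V' = V[folded z_def \<delta>_def, folded r2_def]
  \<comment> \<open>Equal pair products make the linear coefficient \<open>- b1\<close> times the
    cubic one.\<close>
  have e1: "(b1 - b3 * c3) * (c2 - a1 - 2) + \<delta> * (r2 + b1) = 0"
    using V'(1,2) by Groebner_Basis.algebra
  have "b1 * (b1 - b3 * c3) = b1 * (\<delta> * (z + c2))"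
    using V'(3) by Groebner_Basis.algebra
  then have e0: "b1 - b3 * c3 = \<delta> * (z + c2)"
    using \<open>b1 > 0\<close> by simp
  \<comment> \<open>Inserting \<open>e0\<close> into \<open>e1\<close> leaves \<delta> times a
    bracket, which collapses to \<open>- c2 * b2\<close> because the two expressions for the valency
    agree.\<close>
  have "\<delta> * (c2 * b2) = 0"
    using e1 e0 assms(1) unfolding r2_def z_def by Groebner_Basis.algebra
  then have "\<delta> = 0" using assms by simp
  then show "b3 = 1 + a4" "b3 * c3 = b1"
    using e0 unfolding \<delta>_def by auto
qed

text \<open>
  When \<open>b\<^sub>3 = 1 + a\<^sub>4\<close> and \<open>b\<^sub>3 c\<^sub>3 = b\<^sub>1\<close>, the quartic divided by \<open>y\<^sup>2\<close> is a quadratic in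
  \<open>y - b\<^sub>1 / y\<close>.
\<close>

lemma quartic_root_quadratic:
  fixes a1 a2 a4 b1 b3 c2 c3 y :: real
  assumes "b3 = 1 + a4" "b3 * c3 = b1" "b1 > 0"
    and Q: "quartic a1 b1 c2 a2 b3 c3 a4 y = 0"
  shows "y \<noteq> 0"
    and "(y - b1 / y - (1 + a2 - c3)) * (y - b1 / y - (a1 + 2)) = c2 * (b1 - c3)"
proof -
  show "y \<noteq> 0"
  proof
    assume "y = 0"
    then have "b3 * c3 * b1 = 0" using Q assms(1) unfolding quartic_def by simp
    then show False using assms(2,3) by simp
  qed
  define e where "e = b1 / y"
  have "y * e = b1" using \<open>y \<noteq> 0\<close> unfolding e_def by simp
  have "quartic a1 b1 c2 a2 b3 c3 a4 y
     = (y^2 - b1 - (1 + a2 - c3) * y) * (y^2 - b1 - (a1 + 2) * y) - c2 * (b1 - c3) * y^2"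
    using assms(1,2) unfolding quartic_def by Groebner_Basis.algebra
  also have "\<dots> = y^2 * ((y - e - (1 + a2 - c3)) * (y - e - (a1 + 2)) - c2 * (b1 - c3))"
    unfolding \<open>y * e = b1\<close>[symmetric] by Groebner_Basis.algebra
  finally have "y^2 * ((y - e - (1 + a2 - c3)) * (y - e - (a1 + 2)) - c2 * (b1 - c3)) = 0"
    using Q by simp
  then show "(y - b1 / y - (1 + a2 - c3)) * (y - b1 / y - (a1 + 2)) = c2 * (b1 - c3)"
    using \<open>y \<noteq> 0\<close> unfolding e_def by simp
qed

text \<open>After clearing denominators the difference factors as
  \<open>(x - y) * (x * y + r)\<close>. This translates equal values of \<open>y - b1 / y\<close>
  into products \<open>- b1\<close>.\<close>

lemma diff_divide_eq_iff:
  fixes x y r :: real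
  assumes "x \<noteq> 0" "y \<noteq> 0" "x \<noteq> y"
  shows "x - r / x = y - r / y \<longleftrightarrow> x * y = - r"
proof -
  have "x - r / x = y - r / y \<longleftrightarrow> (x - y) * (x * y + r) = 0"
    using assms(1,2) by (simp add: field_simps power2_eq_square)
  then show ?thesis
    using assms(3) by (auto simp: add_eq_0_iff2)
qed

text \<open>Subtracting two of the equations shows that a solution different from \<open>u\<close>
  must be \<open>p + q - u\<close>.\<close>

lemma quadratic_two_roots:
  fixes u v w p q r :: "'a :: idom"
  assumes "(u - p) * (u - q) = r" "(v - p) * (v - q) = r" "(w - p) * (w - q) = r"
  shows "u = v \<or> v = w \<or> u = w"
proof -
  have "(u - v) * (u + v - (p + q)) = (u - p) * (u - q) - (v - p) * (v - q)"
    "(u - w) * (u + w - (p + q)) = (u - p) * (u - q) - (w - p) * (w - q)"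
    by (simp_all add: algebra_simps)
  then have "(u - v) * (u + v - (p + q)) = 0" "(u - w) * (u + w - (p + q)) = 0"
    using assms by simp_all
  then have "u = v \<or> u + v = p + q" "u = w \<or> u + w = p + q"
    by simp_all
  then show ?thesis by (metis add_left_cancel)
qed

text \<open>The quadratic in \<open>y - b1 / y\<close> has at most two roots, so among any three of
  the four numbers two share a value and hence have product \<open>- b1\<close>. Partners are
  unique, and signs and order rule out the matchings 12|34 and 14|23.\<close>

lemma quartic_roots_paired:
  fixes a1 a2 a4 b1 b3 c2 c3 y1 y2 y3 y4 :: real
  assumes D: "b3 = 1 + a4" "b3 * c3 = b1" "b1 > 0"
    and ord: "y1 > y2" "y2 > y3" "y3 > y4"
    and Q: "\<And>y. y \<in> {y1, y2, y3, y4} \<Longrightarrow> quartic a1 b1 c2 a2 b3 c3 a4 y = 0"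
  shows "y1 * y3 = - b1" "y2 * y4 = - b1"
proof -
  note R = quartic_root_quadratic[OF D Q]
  have pair: "x * y = - b1 \<or> y * z = - b1 \<or> x * z = - b1"
    if "x \<in> {y1, y2, y3, y4}" "y \<in> {y1, y2, y3, y4}" "z \<in> {y1, y2, y3, y4}"
      "x \<noteq> y" "y \<noteq> z" "x \<noteq> z" for x y z
    using quadratic_two_roots[OF R(2)[OF that(1)] R(2)[OF that(2)] R(2)[OF that(3)]]
      R(1) that by (metis diff_divide_eq_iff)
  have p123: "y1 * y2 = - b1 \<or> y2 * y3 = - b1 \<or> y1 * y3 = - b1"
    and p124: "y1 * y2 = - b1 \<or> y2 * y4 = - b1 \<or> y1 * y4 = - b1"
    and p134: "y1 * y3 = - b1 \<or> y3 * y4 = - b1 \<or> y1 * y4 = - b1"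
    using ord by (intro pair; simp)+
  have inj: "y = z" if "x * y = - b1" "x * z = - b1" for x y z
  proof -
    have "x \<noteq> 0" "x * y = x * z" using that \<open>b1 > 0\<close> by auto
    then show ?thesis by simp
  qed
  \<comment> \<open>The pairs are nested around zero, \<open>x > y > 0 > z > w\<close>, so their
    products differ in absolute value.\<close>
  have cross: False if "x > y" "y > z" "z > w" "x * w = - b1" "y * z = - b1" for x y z w
  proof -
    have neg: "x * w < 0" "y * z < 0" using that \<open>b1 > 0\<close> by auto
    then have "x > 0" "w < 0" "y > 0" "z < 0"
      using that(1-3) unfolding mult_less_0_iff by auto
    then have "y * (- z) < x * (- w)"
      using that by (intro mult_strict_mono) auto
    then show False using that by simp
  qed
  \<comment> \<open>A negative product of the two largest numbers makes \<open>y3\<close> and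
    \<open>y4\<close> both negative, although they would have to be partners with a negative
    product.\<close>
  have 12: "y1 * y2 \<noteq> - b1"
  proof
    assume h: "y1 * y2 = - b1"
    then have "y1 * y3 \<noteq> - b1" "y1 * y4 \<noteq> - b1"
      using inj[of y1 y2 y3] inj[of y1 y2 y4] ord by auto
    then have "y3 * y4 = - b1" using p134 by blast
    have "y1 > 0" "y2 < 0" using h \<open>b1 > 0\<close> ord
      by (smt (verit) mult_nonneg_nonneg mult_nonpos_nonpos)+
    then have "y3 * y4 > 0" using ord by (simp add: mult_neg_neg)
    then show False using \<open>y3 * y4 = - b1\<close> \<open>b1 > 0\<close> by simp
  qed
  have 14: "y1 * y4 \<noteq> - b1"
  proof
    assume h: "y1 * y4 = - b1"
    then have "y1 * y3 \<noteq> - b1" using inj[of y1 y4 y3] ord by auto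
    then have "y2 * y3 = - b1" using p123 12 by blast
    then show False using cross h ord by blast
  qed
  show "y2 * y4 = - b1" using p124 12 14 by blast
  then have "y2 * y3 \<noteq> - b1" using inj[of y2 y4 y3] ord by auto
  then show "y1 * y3 = - b1" using p123 12 by blast
qed

text \<open>The partner is \<open>y' = - b1 / y\<close>, so the sum of a pair is exactly the
  variable of the quadratic.\<close>

lemma paired_root_sum:
  fixes a1 a2 a4 b1 b3 c2 c3 y y' :: real
  assumes D: "b3 = 1 + a4" "b3 * c3 = b1" "b1 > 0"
    and Q: "quartic a1 b1 c2 a2 b3 c3 a4 y = 0"
    and "y * y' = - b1"
  shows "(y + y' - (1 + a2 - c3)) * (y + y' - (a1 + 2)) = c2 * (b1 - c3)"
proof -
  have "y' = - b1 / y"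
    using quartic_root_quadratic(1)[OF D Q] assms(5) by (simp add: field_simps)
  then have "y + y' = y - b1 / y" by simp
  then show ?thesis
    using quartic_root_quadratic(2)[OF D Q] by simp
qed

text \<open>Both pair sums satisfy the quadratic with right side \<open>c2 * (b1 - c3)\<close>. It
  has the root \<open>a1 + 2\<close> exactly when \<open>b1 = c3\<close>, and since
  \<open>b3 * c3 = b1\<close> this means \<open>b3 = 1\<close>, that is,
  \<open>a4 = 0\<close>.\<close>

lemma a4_eq_0_iff_root_sum:
  fixes a1 a2 a4 b1 b2 b3 c2 c3 y1 y2 y3 y4 :: real
  assumes D: "b3 = 1 + a4" "b3 * c3 = b1" "b1 > 0"
    and "1 + a1 + b1 = c2 + a2 + b2" "b2 > 0" "c2 > 0"
    and ord: "y1 > y2" "y2 > y3" "y3 > y4"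
    and Q: "\<And>y. y \<in> {y1, y2, y3, y4} \<Longrightarrow> quartic a1 b1 c2 a2 b3 c3 a4 y = 0"
  shows "a4 = 0 \<longleftrightarrow> y1 + y3 = a1 + 2"
proof -
  note T = quartic_roots_paired[OF D ord Q, simplified]
  have S: "(y1 + y3 - (1 + a2 - c3)) * (y1 + y3 - (a1 + 2)) = c2 * (b1 - c3)"
    "(y2 + y4 - (1 + a2 - c3)) * (y2 + y4 - (a1 + 2)) = c2 * (b1 - c3)"
    using paired_root_sum[OF D Q] T by auto
  show ?thesis
  proof
    assume "a4 = 0"
    then have "b1 = c3" using D by simp
    then have "y1 + y3 = a1 + 2 \<or> y1 + y3 = 1 + a2 - c3" "y2 + y4 = a1 + 2 \<or> y2 + y4 = 1 + a2 - c3"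
      using S by auto
    \<comment> \<open>The two roots differ by \<open>b2 + c2\<close>. As
      \<open>y1 + y3 > y2 + y4\<close>, the first pair takes the larger root.\<close>
    moreover have "1 + a2 - c3 < a1 + 2" using assms(4-6) \<open>b1 = c3\<close> by linarith
    ultimately show "y1 + y3 = a1 + 2" using ord by linarith
  next
    assume "y1 + y3 = a1 + 2"
    then have "b1 = c3" using S(1) \<open>c2 > 0\<close> by simp
    then have "a4 * c3 = 0" using D by (simp add: algebra_simps)
    then show "a4 = 0" using \<open>b1 = c3\<close> D(3) by simp
  qed
qed

text \<open>The left side equates the coefficients of the first three distance matrices in
  \<open>c2 * c3 * c4\<close> times the square of the fourth. The first difference is a positive
  multiple of \<open>b3 - (1 + a4)\<close>; once this is zero, \<open>r = b1 * a4\<close> and the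
  second is a positive multiple of \<open>b3 * c3 - b1\<close>.\<close>

lemma array_condition_iff:
  fixes k a1 a2 a3 a4 b1 b2 b3 c2 c3 c4 q r :: real
  assumes "k = 1 + a1 + b1" "k = c2 + a2 + b2" "k = c3 + a3 + b3" "k = c4 + a4"
    and "b2 > 0" "b3 > 0" "c4 > 0"
    and q: "q = b3 * (a3 + a4 - a1)" and r: "r = b3 * c4 + a4 * a4 - a1 * a4 - k"
  shows "b1 * b2 * b3 * a4 = b2 * b3 * r \<and>
      b2 * b3 * r = b3 * (c4 * q + (a4 - a2) * r - b1 * c2 * a4)
    \<longleftrightarrow> b3 = 1 + a4 \<and> b3 * c3 = b1"
proof -
  have "b2 * b3 * r - b1 * b2 * b3 * a4 = b2 * b3 * c4 * (b3 - (1 + a4))"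
    using assms(1,4) r by Groebner_Basis.algebra
  then have 1: "b1 * b2 * b3 * a4 = b2 * b3 * r \<longleftrightarrow> b3 = 1 + a4"
    using assms(5-7) by (smt (verit) mult_eq_0_iff)
  have "b2 * b3 * r = b3 * (c4 * q + (a4 - a2) * r - b1 * c2 * a4) \<longleftrightarrow> b3 * c3 = b1" if "b3 = 1 + a4"
  proof -
    have "r = b1 * a4" using that assms(1,4) r by Groebner_Basis.algebra
    then have "b2 * b3 * r - b3 * (c4 * q + (a4 - a2) * r - b1 * c2 * a4) = b3 * c4 * (b3 * c3 - b1)"
      using that assms(1-4) q by Groebner_Basis.algebra
    then show ?thesis using assms(6,7) by (smt (verit) mult_eq_0_iff)
  qed
  then show ?thesis using 1 by blast
qed

section \<open>Distances and distance matrices\<close>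

locale connected_pair_graph = pair_graph +
  assumes connected_G: "Digraph_Component.connected (with_proj G)"
begin

lemma ex_awalk:
  assumes "u \<in> pverts G" "v \<in> pverts G"
  shows "\<exists>p. awalk u p v"
proof -
  have "strongly_connected (with_proj G)"
    using connected_G sym_arcs symmetric_connected_imp_strongly_connected by blast
  then show ?thesis
    using assms by (simp add: strongly_connected_def reachable_awalk)
qed

lemma ex_shortest_awalk:
  assumes "u \<in> pverts G" "v \<in> pverts G"
  obtains p where "awalk u p v" "length p = gdist G u v"
proof -
  obtain p where "awalk u p v"
    using ex_awalk assms by blast
  then have "\<exists>q. awalk u q v \<and> length q = length p"
    by blast
  then have "\<exists>q. awalk u q v \<and> length q = gdist G u v"
    unfolding gdist_def by (rule LeastI)
  then show thesis
    using that by blast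
qed

lemma gdist_le: "awalk u p v \<Longrightarrow> gdist G u v \<le> length p"
  unfolding gdist_def by (rule Least_le) blast

lemma length_rev_path: "length (rev_path p) = length p"
  by (induct p) auto

lemma gdist_commute:
  assumes "u \<in> pverts G" "v \<in> pverts G"
  shows "gdist G u v = gdist G v u"
proof -
  have "gdist G y x \<le> gdist G x y" if "x \<in> pverts G" "y \<in> pverts G" for x y
  proof -
    obtain p where p: "awalk x p y" "length p = gdist G x y"
      using ex_shortest_awalk \<open>x \<in> pverts G\<close> \<open>y \<in> pverts G\<close> by blast
    then show ?thesis
      using gdist_le[of y "rev_path p" x] by (simp add: length_rev_path)
  qed
  then show ?thesis
    using assms by (simp add: le_antisym)
qed

lemma gdist_eq_0_iff:
  assumes "u \<in> pverts G" "v \<in> pverts G"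
  shows "gdist G u v = 0 \<longleftrightarrow> u = v"
proof
  assume "gdist G u v = 0"
  then show "u = v"
    by (metis assms ex_shortest_awalk awalk_empty_ends length_0_conv)
next
  assume "u = v"
  then show "gdist G u v = 0"
    using gdist_le[of u "[]" v] assms by (simp add: awalk_Nil_iff)
qed

lemma gdist_step:
  assumes "u \<in> pverts G" "(v, w) \<in> parcs G"
  shows "gdist G u w \<le> gdist G u v + 1"
proof -
  have "v \<in> pverts G" "w \<in> pverts G" "(w, v) \<in> parcs G"
    using assms(2) by (auto dest: wellformed' arcs_symmetric)
  moreover obtain p where "awalk v p u" "length p = gdist G v u"
    using ex_shortest_awalk assms \<open>v \<in> pverts G\<close> by blast
  ultimately have "gdist G w u \<le> gdist G v u + 1"
    using gdist_le[of w "(w, v) # p" u] by (simp add: awalk_Cons_iff)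
  then show ?thesis
    using gdist_commute assms \<open>v \<in> pverts G\<close> \<open>w \<in> pverts G\<close> by metis
qed

text \<open>The witness is the second vertex of a shortest walk from \<open>v\<close> to
  \<open>u\<close>; \<open>gdist_step\<close> prevents it from being closer to \<open>u\<close> than
  \<open>i\<close>.\<close>

lemma gdist_pred:
  assumes "u \<in> pverts G" "v \<in> pverts G" "gdist G u v = Suc i"
  obtains w where "(v, w) \<in> parcs G" "gdist G u w = i"
proof -
  obtain p where p: "awalk v p u" "length p = Suc i"
    using ex_shortest_awalk assms gdist_commute by metis
  then obtain e q where "p = e # q" by (cases p) auto
  with p obtain w where w: "(v, w) \<in> parcs G" "awalk w q u" "length q = i"
    by (cases e) (auto simp: awalk_Cons_iff)
  have "w \<in> pverts G" using w by (auto dest: wellformed')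
  then have "gdist G u w \<le> i"
    using gdist_le[OF w(2)] w(3) gdist_commute assms by metis
  moreover have "Suc i \<le> gdist G u w + 1"
    using gdist_step[of u w v] w assms arcs_symmetric by auto
  ultimately show thesis using that w by auto
qed

lemma gdist_eq_1_iff:
  assumes "u \<in> pverts G" "v \<in> pverts G"
  shows "gdist G u v = 1 \<longleftrightarrow> (u, v) \<in> parcs G"
proof
  assume "gdist G u v = 1"
  then obtain w where "(v, w) \<in> parcs G" "gdist G u w = 0"
    using gdist_pred assms by (metis One_nat_def)
  then show "(u, v) \<in> parcs G"
    using gdist_eq_0_iff assms by (auto dest: wellformed' arcs_symmetric)
next
  assume uv: "(u, v) \<in> parcs G"
  then have "gdist G u v \<le> 1" 
    using gdist_step[of u u v] gdist_eq_0_iff[of u u] assms by simp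
  moreover have "gdist G u v \<noteq> 0"
    using uv no_loops' gdist_eq_0_iff assms by blast
  ultimately show "gdist G u v = 1" by simp
qed

lemma finite_gdist_set: "finite {gdist G u v | u v. u \<in> pverts G \<and> v \<in> pverts G}"
  using finite_image_set2[of "\<lambda>u. u \<in> pverts G" "\<lambda>v. v \<in> pverts G" "gdist G"] pair_finite_verts
  by simp

lemma pverts_nonempty: "pverts G \<noteq> {}"
  using connected_G by (simp add: connected_conv)

lemma gdist_le_diameter:
  assumes "u \<in> pverts G" "v \<in> pverts G"
  shows "gdist G u v \<le> graph_diameter G"
  unfolding graph_diameter_def using finite_gdist_set assms by (intro Max_ge) auto

lemma ex_gdist_diameter:
  obtains u v where "u \<in> pverts G" "v \<in> pverts G" "gdist G u v = graph_diameter G"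
proof -
  have "graph_diameter G \<in> {gdist G u v | u v. u \<in> pverts G \<and> v \<in> pverts G}"
    unfolding graph_diameter_def using finite_gdist_set pverts_nonempty by (intro Max_in) auto
  then show thesis using that by auto
qed

text \<open>Starting at a diametral pair and keeping \<open>u0\<close> fixed,
  \<open>gdist_pred\<close> lowers the distance one step at a time.\<close>

lemma ex_gdist_eq:
  assumes "i \<le> graph_diameter G"
  obtains u v where "u \<in> pverts G" "v \<in> pverts G" "gdist G u v = i"
proof -
  obtain u0 v0 where u0: "u0 \<in> pverts G" and v0: "v0 \<in> pverts G" "gdist G u0 v0 = graph_diameter G"
    by (rule ex_gdist_diameter)
  have "\<exists>v\<in>pverts G. gdist G u0 v = i"
    using assms
  proof (induct i rule: inc_induct)
    case base
    then show ?case using v0 by blast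
  next
    case (step i)
    then obtain v where "v \<in> pverts G" "gdist G u0 v = Suc i" by blast
    then obtain w where "(v, w) \<in> parcs G" "gdist G u0 w = i"
      using gdist_pred u0 by metis
    then show ?case using in_arcsD2 by blast
  qed
  then show thesis using that u0 by blast
qed

text \<open>The distance-\<open>i\<close> matrix acting on functions on the vertices.\<close>

definition dist_sum :: "nat \<Rightarrow> ('a \<Rightarrow> real) \<Rightarrow> 'a \<Rightarrow> real" where
  "dist_sum i f u = (\<Sum>w\<in>pverts G. if gdist G u w = i then f w else 0)"

lemma dist_sum_cong:
  "(\<And>v. v \<in> pverts G \<Longrightarrow> f v = g v) \<Longrightarrow> dist_sum i f u = dist_sum i g u"
  unfolding dist_sum_def by (rule sum.cong) auto

lemma dist_sum_0:
  assumes "u \<in> pverts G"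
  shows "dist_sum 0 f u = f u"
proof -
  have "dist_sum 0 f u = (\<Sum>w\<in>pverts G. if w = u then f w else 0)"
    unfolding dist_sum_def using assms by (intro sum.cong) (auto simp: gdist_eq_0_iff)
  also have "\<dots> = f u"
    using assms by (simp add: sum.delta pair_finite_verts)
  finally show ?thesis .
qed

lemma finite_neighbours: "finite (neighbours G u)"
  unfolding neighbours_def using pair_finite_verts
  by (rule finite_subset[rotated]) (auto dest: wellformed')

lemma dist_sum_1:
  assumes "u \<in> pverts G"
  shows "dist_sum 1 f u = (\<Sum>v\<in>neighbours G u. f v)"
proof -
  have "neighbours G u = {w \<in> pverts G. gdist G u w = 1}"
    unfolding neighbours_def using assms gdist_eq_1_iff by (auto dest: wellformed')
  then show ?thesis
    unfolding dist_sum_def using pair_finite_verts by (simp add: sum.inter_filter)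
qed

lemma dist_sum_add: "dist_sum i (\<lambda>v. f v + g v) u = dist_sum i f u + dist_sum i g u"
  unfolding dist_sum_def sum.distrib[symmetric] by (rule sum.cong) auto

lemma dist_sum_mult: "dist_sum i (\<lambda>v. x * f v) u = x * dist_sum i f u"
  unfolding dist_sum_def sum_distrib_left by (rule sum.cong) auto

text \<open>On an indicator function the operator returns a matrix entry; this is how operator
  identities become counts.\<close>

lemma dist_sum_delta:
  assumes "u \<in> pverts G" "v \<in> pverts G"
  shows "dist_sum i (\<lambda>w. if w = v then 1 else 0) u = (if gdist G u v = i then 1 else 0)"
proof -
  have "dist_sum i (\<lambda>w. if w = v then 1 else 0) u
      = (\<Sum>w\<in>pverts G. if w = v then (if gdist G u w = i then 1 else 0) else 0)"
    unfolding dist_sum_def by (rule sum.cong) auto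
  also have "\<dots> = (if gdist G u v = i then 1 else 0)"
    using assms by (simp add: sum.delta pair_finite_verts)
  finally show ?thesis .
qed

end

section \<open>Intersection numbers and the three-term recurrence\<close>

locale distance_regular_graph = connected_pair_graph +
  fixes c a b :: "nat \<Rightarrow> nat"
  assumes inter: "intersection_numbers G c a b"
begin

text \<open>The intersection numbers are re-indexed by the distance \<open>i\<close> being counted.
  By the triangle inequality the default value is 0, and \<open>b (gdist G u v)\<close> stands for
  the index \<open>i - 1\<close>.\<close>

lemma card_neighbours_at:
  assumes "u \<in> pverts G" "v \<in> pverts G"
  shows "card {w \<in> neighbours G v. gdist G u w = i} =
    (if gdist G u v = i then a i else if gdist G u v = i + 1 then c (i + 1)
     else if gdist G u v + 1 = i then b (gdist G u v) else 0)"
proof -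
  have *: "card {w \<in> neighbours G v. gdist G u w + 1 = gdist G u v} = c (gdist G u v)"
    "card {w \<in> neighbours G v. gdist G u w = gdist G u v} = a (gdist G u v)"
    "card {w \<in> neighbours G v. gdist G u w = gdist G u v + 1} = b (gdist G u v)"
    using inter assms unfolding intersection_numbers_def by blast+
  have **: "gdist G u w \<le> gdist G u v + 1" "gdist G u v \<le> gdist G u w + 1"
    if "w \<in> neighbours G v" for w
    using gdist_step[OF assms(1)] that arcs_symmetric unfolding neighbours_def by auto
  consider "gdist G u v = i" | "gdist G u v = i + 1" | "gdist G u v + 1 = i"
    | "gdist G u v \<noteq> i" "gdist G u v \<noteq> i + 1" "gdist G u v + 1 \<noteq> i" by blast
  then show ?thesis
  proof cases
    case 1 then show ?thesis using * by simp
  next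
    case 2 then show ?thesis using * by simp
  next
    case 3 then show ?thesis using *(3) by auto
  next
    case 4
    then have "{w \<in> neighbours G v. gdist G u w = i} = {}"
      using ** by fastforce
    then show ?thesis using 4 by (simp only: card.empty if_False)
  qed
qed

text \<open>This is \<open>A A\<^sub>i = b\<^sub>i\<^sub>-\<^sub>1 A\<^sub>i\<^sub>-\<^sub>1 +
  a\<^sub>i A\<^sub>i + c\<^sub>i\<^sub>+\<^sub>1 A\<^sub>i\<^sub>+\<^sub>1\<close> applied to
  \<open>f\<close>: after exchanging the sums, the weight of \<open>f w\<close> is the number of
  neighbours of \<open>u\<close> at distance \<open>i\<close> from \<open>w\<close>.\<close>

lemma dist_sum_rec:
  assumes u: "u \<in> pverts G"
  shows "dist_sum 1 (dist_sum i f) u =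
    (if i = 0 then 0 else real (b (i - 1)) * dist_sum (i - 1) f u)
    + real (a i) * dist_sum i f u + real (c (i + 1)) * dist_sum (i + 1) f u"
proof -
  have "dist_sum 1 (dist_sum i f) u
      = (\<Sum>w\<in>pverts G. \<Sum>v\<in>neighbours G u. if gdist G v w = i then f w else 0)"
    unfolding dist_sum_1[OF u] unfolding dist_sum_def by (rule sum.swap)
  also have "\<dots> = (\<Sum>w\<in>pverts G. f w * real (card {v \<in> neighbours G u. gdist G w v = i}))"
  proof (rule sum.cong[OF refl])
    fix w assume w: "w \<in> pverts G"
    have "(\<Sum>v\<in>neighbours G u. if gdist G v w = i then f w else 0)
        = (\<Sum>v\<in>neighbours G u. if gdist G w v = i then f w else 0)"
      using w gdist_commute by (intro sum.cong) (auto simp: neighbours_def dest: wellformed')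
    also have "\<dots> = (\<Sum>v\<in>{v \<in> neighbours G u. gdist G w v = i}. f w)"
      using finite_neighbours by (rule sum.inter_filter[symmetric])
    finally show "(\<Sum>v\<in>neighbours G u. if gdist G v w = i then f w else 0)
        = f w * real (card {v \<in> neighbours G u. gdist G w v = i})"
      by (simp add: mult.commute)
  qed
  also have "\<dots> = (\<Sum>w\<in>pverts G.
      (if i = 0 then 0 else real (b (i - 1)) * (if gdist G u w = i - 1 then f w else 0))
      + real (a i) * (if gdist G u w = i then f w else 0)
      + real (c (i + 1)) * (if gdist G u w = i + 1 then f w else 0))"
    using u gdist_commute by (intro sum.cong refl) (auto simp: card_neighbours_at)
  finally show ?thesis
    unfolding dist_sum_def by (simp add: sum.distrib sum_distrib_left)
qed

lemma intersection_sum: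
  assumes "i \<le> graph_diameter G"
  shows "c i + a i + b i = b 0"
proof -
  obtain u v where uv: "u \<in> pverts G" "v \<in> pverts G" "gdist G u v = i"
    using ex_gdist_eq assms by blast
  \<comment> \<open>The pair \<open>v\<close>, \<open>v\<close> at distance 0 identifies
    \<open>b 0\<close> as the degree of \<open>v\<close>.\<close>
  have "neighbours G v = {w \<in> neighbours G v. gdist G v w = 0 + 1}"
    using gdist_eq_1_iff uv by (auto simp: neighbours_def dest: wellformed')
  then have b0: "card (neighbours G v) = b 0"
    using inter uv gdist_eq_0_iff[of v v] unfolding intersection_numbers_def by metis
  let ?C = "{w \<in> neighbours G v. gdist G u w + 1 = i}"
  let ?A = "{w \<in> neighbours G v. gdist G u w = i}"
  let ?B = "{w \<in> neighbours G v. gdist G u w = i + 1}"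
  have "gdist G u w + 1 = i \<or> gdist G u w = i \<or> gdist G u w = i + 1"
    if "w \<in> neighbours G v" for w
    using gdist_step[of u v w] gdist_step[of u w v] that uv arcs_symmetric[of v w]
    unfolding neighbours_def by auto
  then have eq: "neighbours G v = ?C \<union> ?A \<union> ?B" by blast
  have "card (?C \<union> ?A \<union> ?B) = card ?C + card ?A + card ?B"
    using finite_neighbours by (subst card_Un_disjoint; auto)+
  moreover have "card ?C = c i" "card ?A = a i" "card ?B = b i"
    using inter uv unfolding intersection_numbers_def by blast+
  ultimately show ?thesis using b0 eq by metis
qed

lemma c_1:
  assumes "1 \<le> graph_diameter G"
  shows "c 1 = 1"
proof -
  obtain u v where uv: "u \<in> pverts G" "v \<in> pverts G" "gdist G u v = 1"
    using ex_gdist_eq assms by blast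
  have "{w \<in> neighbours G v. gdist G u w = 0} = {u}"
    using uv gdist_eq_0_iff gdist_eq_1_iff arcs_symmetric by (auto simp: neighbours_def dest: wellformed')
  then show ?thesis
    using card_neighbours_at[of u v 0] uv by simp
qed

lemma b_diameter: "b (graph_diameter G) = 0"
proof -
  obtain u v where uv: "u \<in> pverts G" "v \<in> pverts G" "gdist G u v = graph_diameter G"
    by (rule ex_gdist_diameter)
  have "{w \<in> neighbours G v. gdist G u w = graph_diameter G + 1} = {}"
    using uv gdist_le_diameter by (fastforce simp: neighbours_def dest: wellformed')
  then show ?thesis
    using card_neighbours_at[of u v "graph_diameter G + 1"] uv
    by (simp only: card.empty) simp
qed

text \<open>A single edge between the spheres of radius \<open>i\<close> and \<open>Suc i\<close>
  around \<open>u\<close> proves both claims, one from each end.\<close>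

lemma
  assumes "i < graph_diameter G"
  shows b_pos: "b i > 0" and c_Suc_pos: "c (Suc i) > 0"
proof -
  obtain u v where uv: "u \<in> pverts G" "v \<in> pverts G" "gdist G u v = Suc i"
    using ex_gdist_eq[of "Suc i"] assms by auto
  obtain w where w: "(v, w) \<in> parcs G" "gdist G u w = i"
    using gdist_pred uv by blast
  then have wV: "w \<in> pverts G" by (auto dest: wellformed')
  have "w \<in> {w \<in> neighbours G v. gdist G u w = i}"
    using w by (auto simp: neighbours_def)
  then have "card {w \<in> neighbours G v. gdist G u w = i} > 0"
    using finite_neighbours by (auto simp: card_gt_0_iff)
  then show "c (Suc i) > 0"
    using card_neighbours_at[of u v i] uv by simp
  have "v \<in> {x \<in> neighbours G w. gdist G u x = Suc i}"
    using w uv arcs_symmetric by (auto simp: neighbours_def)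
  then have "card {x \<in> neighbours G w. gdist G u x = Suc i} > 0"
    using finite_neighbours by (auto simp: card_gt_0_iff)
  then show "b i > 0"
    using card_neighbours_at[of u w "Suc i"] uv w wV by simp
qed

section \<open>Eigenvectors as functions on the vertices\<close>

lemma eigenfunction:
  assumes "\<theta> \<in> adjacency_eigenvalues G"
  obtains f u where "\<And>v. v \<in> pverts G \<Longrightarrow> dist_sum 1 f v = \<theta> * f v"
    "u \<in> pverts G" "f u \<noteq> 0"
proof -
  obtain vs x where vs: "distinct vs" "set vs = pverts G"
    and ev: "eigenvector (adjacency_matrix G vs) x \<theta>"
    using assms unfolding adjacency_eigenvalues_def eigenvalue_def by blast
  let ?n = "length vs" and ?A = "adjacency_matrix G vs"
  have dimA: "dim_row ?A = ?n" "dim_col ?A = ?n"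
    unfolding adjacency_matrix_def by auto
  have x: "x \<in> carrier_vec ?n" "x \<noteq> 0\<^sub>v ?n" "?A *\<^sub>v x = \<theta> \<cdot>\<^sub>v x"
    using ev dimA unfolding eigenvector_def by auto
  \<comment> \<open>Inverting the enumeration \<open>vs\<close> turns the indexed vector into a
    function on vertices.\<close>
  define f where "f v = x $ (the_inv_into {..<?n} ((!) vs) v)" for v
  have inj: "inj_on ((!) vs) {..<?n}"
    using vs(1) by (simp add: inj_on_nth)
  have f: "f (vs ! i) = x $ i" if "i < ?n" for i
    unfolding f_def using the_inv_into_f_f[OF inj] that by simp
  have img: "(!) vs ` {..<?n} = pverts G"
    using vs(2) by (auto simp: set_conv_nth image_def)
  have 1: "dist_sum 1 f v = \<theta> * f v" if v: "v \<in> pverts G" for v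
  proof -
    obtain i where i: "i < ?n" "v = vs ! i" using v img by auto
    have "dist_sum 1 f v = (\<Sum>w\<in>pverts G. if (v, w) \<in> parcs G then f w else 0)"
      unfolding dist_sum_def using v gdist_eq_1_iff by (intro sum.cong) auto
    also have "\<dots> = (\<Sum>j<?n. if (v, vs ! j) \<in> parcs G then f (vs ! j) else 0)"
      unfolding img[symmetric] by (simp add: sum.reindex[OF inj])
    also have "\<dots> = (\<Sum>j<?n. (if (v, vs ! j) \<in> parcs G then 1 else 0) * x $ j)"
      using f by (intro sum.cong) auto
    also have "\<dots> = (?A *\<^sub>v x) $ i"
      using i x(1) unfolding adjacency_matrix_def scalar_prod_def
      by (auto simp: scalar_prod_def lessThan_atLeast0 intro!: sum.cong)
    also have "\<dots> = \<theta> * f v"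
      using i x f by simp
    finally show ?thesis .
  qed
  have "\<exists>i<?n. x $ i \<noteq> 0"
  proof (rule ccontr)
    assume "\<not> ?thesis"
    then have "x = 0\<^sub>v ?n" using x(1) by (intro eq_vecI) auto
    then show False using x(2) by simp
  qed
  then obtain i where "i < ?n" "x $ i \<noteq> 0" by blast
  then have "vs ! i \<in> pverts G" "f (vs ! i) \<noteq> 0"
    using vs f by auto
  then show thesis using that 1 by blast
qed

text \<open>Summing the eigenvalue equation over all vertices counts each \<open>f v\<close> once
  per neighbour of \<open>v\<close>, so \<theta> and \<open>b 0\<close> multiply the total to the
  same value.\<close>

lemma sum_eigenfunction:
  assumes f: "\<And>v. v \<in> pverts G \<Longrightarrow> dist_sum 1 f v = \<theta> * f v" and "\<theta> \<noteq> real (b 0)"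
  shows "(\<Sum>v\<in>pverts G. f v) = 0"
proof -
  have "\<theta> * (\<Sum>v\<in>pverts G. f v) = (\<Sum>v\<in>pverts G. dist_sum 1 f v)"
    unfolding sum_distrib_left by (rule sum.cong) (simp_all only: f)
  also have "\<dots> = (\<Sum>v\<in>pverts G. \<Sum>w\<in>pverts G. if gdist G w v = 1 then f v else 0)"
    unfolding dist_sum_def by (rule sum.swap)
  also have "\<dots> = (\<Sum>v\<in>pverts G. real (b 0) * f v)"
  proof (rule sum.cong[OF refl])
    fix v assume v: "v \<in> pverts G"
    have "(\<Sum>w\<in>pverts G. if gdist G w v = 1 then f v else 0)
       = dist_sum 1 (\<lambda>_. f v) v"
      unfolding dist_sum_def using v gdist_commute by (intro sum.cong) auto
    also have "\<dots> = real (card {w \<in> neighbours G v. gdist G v w = 1}) * f v"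
    proof -
      have "{w \<in> neighbours G v. gdist G v w = 1} = neighbours G v"
        using v gdist_eq_1_iff by (auto simp: neighbours_def dest: wellformed')
      then show ?thesis using dist_sum_1[OF v] by simp
    qed
    also have "\<dots> = real (b 0) * f v"
      using v gdist_eq_0_iff[of v v] by (simp add: card_neighbours_at)
    finally show "(\<Sum>w\<in>pverts G. if gdist G w v = 1 then f v else 0) = real (b 0) * f v" .
  qed
  also have "\<dots> = real (b 0) * (\<Sum>v\<in>pverts G. f v)"
    by (simp add: sum_distrib_left)
  finally show ?thesis using assms(2) by simp
qed

end

section \<open>Diameter four\<close>

locale distance_regular_graph_4 = distance_regular_graph +
  assumes diameter: "graph_diameter G = 4"
begin

lemma array_sums:
  "real (b 0) = 1 + real (a 1) + real (b 1)"
  "real (b 0) = real (c 2) + real (a 2) + real (b 2)"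
  "real (b 0) = real (c 3) + real (a 3) + real (b 3)"
  "real (b 0) = real (c 4) + real (a 4)"
  using intersection_sum[of 1] intersection_sum[of 2] intersection_sum[of 3] intersection_sum[of 4]
    c_1 b_diameter diameter by simp_all

lemma array_pos:
  "real (b 1) > 0" "real (b 2) > 0" "real (b 3) > 0"
  "real (c 2) > 0" "real (c 3) > 0" "real (c 4) > 0"
  using b_pos[of 1] b_pos[of 2] b_pos[of 3] c_Suc_pos[of 1] c_Suc_pos[of 2] c_Suc_pos[of 3] diameter
  by (simp_all add: numeral_2_eq_2 numeral_3_eq_3 numeral_eq_Suc)

lemma
  assumes u: "u \<in> pverts G"
  shows dist_sum_rec_1: "dist_sum 1 (dist_sum 1 f) u =
      real (b 0) * f u + real (a 1) * dist_sum 1 f u + real (c 2) * dist_sum 2 f u"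
    and dist_sum_rec_2: "dist_sum 1 (dist_sum 2 f) u =
      real (b 1) * dist_sum 1 f u + real (a 2) * dist_sum 2 f u + real (c 3) * dist_sum 3 f u"
    and dist_sum_rec_3: "dist_sum 1 (dist_sum 3 f) u =
      real (b 2) * dist_sum 2 f u + real (a 3) * dist_sum 3 f u + real (c 4) * dist_sum 4 f u"
    and dist_sum_rec_4: "dist_sum 1 (dist_sum 4 f) u =
      real (b 3) * dist_sum 3 f u + real (a 4) * dist_sum 4 f u"
proof -
  \<comment> \<open>No two vertices are at distance 5, which cuts off the last recurrence.\<close>
  have "dist_sum 5 f u = 0"
    unfolding dist_sum_def using gdist_le_diameter[OF u] diameter by (intro sum.neutral) fastforce
  then show "dist_sum 1 (dist_sum 1 f) u =
      real (b 0) * f u + real (a 1) * dist_sum 1 f u + real (c 2) * dist_sum 2 f u"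
    "dist_sum 1 (dist_sum 2 f) u =
      real (b 1) * dist_sum 1 f u + real (a 2) * dist_sum 2 f u + real (c 3) * dist_sum 3 f u"
    "dist_sum 1 (dist_sum 3 f) u =
      real (b 2) * dist_sum 2 f u + real (a 3) * dist_sum 3 f u + real (c 4) * dist_sum 4 f u"
    "dist_sum 1 (dist_sum 4 f) u =
      real (b 3) * dist_sum 3 f u + real (a 4) * dist_sum 4 f u"
    using dist_sum_rec[OF u, of 1 f] dist_sum_rec[OF u, of 2 f]
      dist_sum_rec[OF u, of 3 f] dist_sum_rec[OF u, of 4 f] dist_sum_0[OF u, of f]
    by (simp_all add: numeral_2_eq_2[symmetric])
qed

text \<open>One multiplication by the adjacency matrix, carried out in the basis of distance
  matrices. The factor \<open>y\<close> keeps products of the \<open>c\<close>'s on the left, so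
  that nothing is divided.\<close>

lemma dist_sum_lincomb:
  assumes g: "\<forall>v\<in>pverts G.
      y * g v = x1 * dist_sum 1 f v + x2 * dist_sum 2 f v + x3 * dist_sum 3 f v + x4 * dist_sum 4 f v"
    and u: "u \<in> pverts G"
  shows "y * dist_sum 1 g u = real (b 0) * x1 * f u
    + (real (a 1) * x1 + real (b 1) * x2) * dist_sum 1 f u
    + (real (c 2) * x1 + real (a 2) * x2 + real (b 2) * x3) * dist_sum 2 f u
    + (real (c 3) * x2 + real (a 3) * x3 + real (b 3) * x4) * dist_sum 3 f u
    + (real (c 4) * x3 + real (a 4) * x4) * dist_sum 4 f u"
proof -
  have "y * dist_sum 1 g u = dist_sum 1 (\<lambda>v. y * g v) u"
    by (simp only: dist_sum_mult)
  also have "\<dots> = dist_sum 1 (\<lambda>v. x1 * dist_sum 1 f v + x2 * dist_sum 2 f v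
      + x3 * dist_sum 3 f v + x4 * dist_sum 4 f v) u"
    using g by (intro dist_sum_cong) blast
  finally show ?thesis
    unfolding dist_sum_add dist_sum_mult dist_sum_rec_1[OF u] dist_sum_rec_2[OF u]
      dist_sum_rec_3[OF u] dist_sum_rec_4[OF u]
    by (simp only: algebra_simps)
qed

text \<open>
  With \<open>A\<^sub>i\<close> the adjacency matrix of the distance-\<open>i\<close> graph,
  \<open>c\<^sub>2 A\<^sub>2 A\<^sub>4 = b\<^sub>2 b\<^sub>3 A\<^sub>2 + q A\<^sub>3 + r A\<^sub>4\<close>, and \<open>p44 h\<close> is the coefficient of \<open>A\<^sub>h\<close> in
  \<open>c\<^sub>2 c\<^sub>3 c\<^sub>4 A\<^sub>4\<^sup>2\<close>.
\<close>

definition coeff_q :: real where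
  "coeff_q = real (b 3) * (real (a 3) + real (a 4) - real (a 1))"

definition coeff_r :: real where
  "coeff_r = real (b 3) * real (c 4) + real (a 4) * real (a 4) - real (a 1) * real (a 4) - real (b 0)"

definition p44 :: "nat \<Rightarrow> real" where
  "p44 h =
    (if h = 0 then real (b 0) * real (b 1) * real (b 2) * real (b 3)
     else if h = 1 then real (b 1) * real (b 2) * real (b 3) * real (a 4)
     else if h = 2 then real (b 2) * real (b 3) * coeff_r
     else if h = 3 then real (b 3) *
       (real (c 4) * coeff_q + (real (a 4) - real (a 2)) * coeff_r - real (b 1) * real (c 2) * real (a 4))
     else real (c 4) * (real (c 3) * real (b 2) * real (b 3) + (real (a 3) - real (a 2)) * coeff_q
          + real (b 3) * coeff_r - real (b 1) * real (b 3) * real (c 2))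
       + (real (a 4) - real (a 3)) * (real (c 4) * coeff_q + (real (a 4) - real (a 2)) * coeff_r
          - real (b 1) * real (c 2) * real (a 4))
       - real (b 2) * real (c 3) * coeff_r)"

text \<open>Solving each recurrence for its last term, applied to \<open>dist_sum 4 f\<close>,
  yields in turn the products of the first, second, third and fourth distance matrix with the
  fourth.\<close>

lemma dist_sum_4_4:
  assumes u: "u \<in> pverts G"
  shows "real (c 2) * real (c 3) * real (c 4) * dist_sum 4 (dist_sum 4 f) u
    = p44 0 * f u + p44 1 * dist_sum 1 f u + p44 2 * dist_sum 2 f u
      + p44 3 * dist_sum 3 f u + p44 4 * dist_sum 4 f u"
proof -
  let ?g = "dist_sum 4 f"
  have 1: "\<forall>v\<in>pverts G. 1 * dist_sum 1 ?g v = 0 * dist_sum 1 f v + 0 * dist_sum 2 f v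
      + real (b 3) * dist_sum 3 f v + real (a 4) * dist_sum 4 f v"
    using dist_sum_rec_4[of _ f] by simp
  have 2: "\<forall>v\<in>pverts G. real (c 2) * dist_sum 2 ?g v = 0 * dist_sum 1 f v + real (b 2) * real (b 3) * dist_sum 2 f v
      + coeff_q * dist_sum 3 f v + coeff_r * dist_sum 4 f v"
  proof
    fix v assume v: "v \<in> pverts G"
    show "real (c 2) * dist_sum 2 ?g v = 0 * dist_sum 1 f v + real (b 2) * real (b 3) * dist_sum 2 f v
      + coeff_q * dist_sum 3 f v + coeff_r * dist_sum 4 f v"
      using dist_sum_lincomb[OF 1 v] dist_sum_rec_1[OF v, of ?g] bspec[OF 1 v]
      unfolding coeff_q_def coeff_r_def by (simp add: algebra_simps)
  qed
  have 3: "\<forall>v\<in>pverts G. real (c 2) * real (c 3) * dist_sum 3 ?g v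
      = real (b 1) * real (b 2) * real (b 3) * dist_sum 1 f v + real (b 2) * coeff_q * dist_sum 2 f v
      + (real (c 3) * real (b 2) * real (b 3) + (real (a 3) - real (a 2)) * coeff_q
          + real (b 3) * coeff_r - real (b 1) * real (b 3) * real (c 2)) * dist_sum 3 f v
      + (real (c 4) * coeff_q + (real (a 4) - real (a 2)) * coeff_r
          - real (b 1) * real (c 2) * real (a 4)) * dist_sum 4 f v"
  proof
    fix v assume v: "v \<in> pverts G"
    have "real (c 2) * real (c 3) * dist_sum 3 ?g v = real (c 2) * dist_sum 1 (dist_sum 2 ?g) v
      - real (c 2) * real (b 1) * dist_sum 1 ?g v - real (a 2) * (real (c 2) * dist_sum 2 ?g v)"
      using dist_sum_rec_2[OF v, of ?g] by (simp add: algebra_simps)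
    also have "\<dots> = real (b 1) * real (b 2) * real (b 3) * dist_sum 1 f v + real (b 2) * coeff_q * dist_sum 2 f v
      + (real (c 3) * real (b 2) * real (b 3) + (real (a 3) - real (a 2)) * coeff_q
          + real (b 3) * coeff_r - real (b 1) * real (b 3) * real (c 2)) * dist_sum 3 f v
      + (real (c 4) * coeff_q + (real (a 4) - real (a 2)) * coeff_r
          - real (b 1) * real (c 2) * real (a 4)) * dist_sum 4 f v"
      unfolding dist_sum_lincomb[OF 2 v] bspec[OF 2 v] dist_sum_rec_4[OF v, of f]
      by (simp add: algebra_simps)
    finally show "real (c 2) * real (c 3) * dist_sum 3 ?g v
      = real (b 1) * real (b 2) * real (b 3) * dist_sum 1 f v + real (b 2) * coeff_q * dist_sum 2 f v
      + (real (c 3) * real (b 2) * real (b 3) + (real (a 3) - real (a 2)) * coeff_q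
          + real (b 3) * coeff_r - real (b 1) * real (b 3) * real (c 2)) * dist_sum 3 f v
      + (real (c 4) * coeff_q + (real (a 4) - real (a 2)) * coeff_r
          - real (b 1) * real (c 2) * real (a 4)) * dist_sum 4 f v" .
  qed
  have "p44 0 = real (b 0) * real (b 1) * real (b 2) * real (b 3)"
    "p44 1 = real (b 1) * real (b 2) * real (b 3) * real (a 4)"
    "p44 2 = real (b 2) * real (b 3) * coeff_r"
    "p44 3 = real (b 3) *
       (real (c 4) * coeff_q + (real (a 4) - real (a 2)) * coeff_r - real (b 1) * real (c 2) * real (a 4))"
    "p44 4 = real (c 4) * (real (c 3) * real (b 2) * real (b 3) + (real (a 3) - real (a 2)) * coeff_q
          + real (b 3) * coeff_r - real (b 1) * real (b 3) * real (c 2))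
       + (real (a 4) - real (a 3)) * (real (c 4) * coeff_q + (real (a 4) - real (a 2)) * coeff_r
          - real (b 1) * real (c 2) * real (a 4))
       - real (b 2) * real (c 3) * coeff_r"
    unfolding p44_def by simp_all
  note p = this
  have "real (c 2) * real (c 3) * real (c 4) * dist_sum 4 ?g u
    = real (c 2) * real (c 3) * dist_sum 1 (dist_sum 3 ?g) u
      - real (c 3) * real (b 2) * (real (c 2) * dist_sum 2 ?g u)
      - real (a 3) * (real (c 2) * real (c 3) * dist_sum 3 ?g u)"
    using dist_sum_rec_3[OF u, of ?g] by (simp add: algebra_simps)
  \<comment> \<open>Only the coefficient of \<open>dist_sum 1 f u\<close> needs the value of
    \<open>coeff_q\<close>; the others agree with \<open>coeff_q\<close> and \<open>coeff_r\<close>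
    kept as symbols.\<close>
  also have "\<dots> = p44 0 * f u + p44 1 * dist_sum 1 f u + p44 2 * dist_sum 2 f u
      + p44 3 * dist_sum 3 f u + p44 4 * dist_sum 4 f u"
    unfolding dist_sum_lincomb[OF 3 u] bspec[OF 2 u] bspec[OF 3 u] p
    by (simp add: algebra_simps) (simp add: coeff_q_def algebra_simps)
  finally show ?thesis .
qed

section \<open>Common antipodes and strong regularity of the distance-4 graph\<close>

lemma gdist_cases:
  assumes "u \<in> pverts G" "v \<in> pverts G"
  shows "gdist G u v \<in> {0, 1, 2, 3, 4}"
  using gdist_le_diameter[OF assms] diameter by auto

text \<open>In \<open>dist_sum_4_4\<close> for the indicator of \<open>v\<close>, the left side
  counts the common antipodes and the right side retains only the coefficient belonging to the
  distance of \<open>u\<close> and \<open>v\<close>.\<close>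

lemma common_antipodes:
  assumes u: "u \<in> pverts G" and v: "v \<in> pverts G"
  shows "real (c 2) * real (c 3) * real (c 4) *
      real (card {w \<in> pverts G. gdist G u w = 4 \<and> gdist G v w = 4}) = p44 (gdist G u v)"
proof -
  let ?f = "\<lambda>w. if w = v then 1 else (0 :: real)"
  have "dist_sum 4 (dist_sum 4 ?f) u
      = (\<Sum>w\<in>pverts G. if gdist G u w = 4 \<and> gdist G v w = 4 then 1 else 0)"
    unfolding dist_sum_def[of 4 "dist_sum 4 ?f"]
    using v gdist_commute by (intro sum.cong) (auto simp: dist_sum_delta)
  also have "\<dots> = real (card {w \<in> pverts G. gdist G u w = 4 \<and> gdist G v w = 4})"
    using pair_finite_verts by (simp add: sum.inter_filter[symmetric])
  finally have "real (c 2) * real (c 3) * real (c 4) *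
      real (card {w \<in> pverts G. gdist G u w = 4 \<and> gdist G v w = 4})
    = p44 0 * ?f u + p44 1 * dist_sum 1 ?f u + p44 2 * dist_sum 2 ?f u
      + p44 3 * dist_sum 3 ?f u + p44 4 * dist_sum 4 ?f u"
    using dist_sum_4_4[OF u, of ?f] by simp
  also have "\<dots> = p44 (gdist G u v)"
    unfolding dist_sum_delta[OF u v]
    using gdist_cases[OF u v] gdist_eq_0_iff[OF u v] by auto
  finally show ?thesis .
qed

lemma neighbours_distance_graph:
  "u \<in> pverts G \<Longrightarrow> neighbours (distance_graph G 4) u = {w \<in> pverts G. gdist G u w = 4}"
  unfolding neighbours_def distance_graph_def by auto

lemma common_neighbours_distance_graph:
  assumes "u \<in> pverts G" "v \<in> pverts G"
  shows "real (c 2) * real (c 3) * real (c 4) *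
    real (card (neighbours (distance_graph G 4) u \<inter> neighbours (distance_graph G 4) v))
     = p44 (gdist G u v)"
proof -
  have "neighbours (distance_graph G 4) u \<inter> neighbours (distance_graph G 4) v
      = {w \<in> pverts G. gdist G u w = 4 \<and> gdist G v w = 4}"
    using assms by (auto simp: neighbours_distance_graph)
  then show ?thesis using common_antipodes[OF assms] by simp
qed

lemma pair_graph_distance_graph: "pair_graph (distance_graph G 4)"
proof
  show "finite (parcs (distance_graph G 4))"
    unfolding distance_graph_def
    using pair_finite_verts by (auto intro: finite_subset[of _ "pverts G \<times> pverts G"])
  show "symmetric (with_proj (distance_graph G 4))"
    unfolding symmetric_def sym_def distance_graph_def using gdist_commute by auto
  show "fst e \<noteq> snd e" if "e \<in> parcs (distance_graph G 4)" for e
    using that gdist_eq_0_iff unfolding distance_graph_def by force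
qed (use pair_finite_verts in \<open>auto simp: distance_graph_def\<close>)

text \<open>The number of common neighbours in the distance-4 graph depends only on the distance in
  \<open>G\<close>. The degrees and the adjacent pairs, at distances 0 and 4, are thus uniform, and
  the condition comes from the nonadjacent pairs, at distances 1, 2 and 3.\<close>

lemma strongly_regular_distance_graph_iff:
  "strongly_regular (distance_graph G 4) \<longleftrightarrow> p44 1 = p44 2 \<and> p44 2 = p44 3"
    (is "strongly_regular ?H \<longleftrightarrow> ?R")
proof
  assume "strongly_regular ?H"
  then obtain m where m: "\<And>u v. u \<in> pverts ?H \<Longrightarrow> v \<in> pverts ?H \<Longrightarrow> u \<noteq> v \<Longrightarrow> (u, v) \<notin> parcs ?H
      \<Longrightarrow> card (neighbours ?H u \<inter> neighbours ?H v) = m"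
    unfolding strongly_regular_def by blast
  have "p44 h = real (c 2) * real (c 3) * real (c 4) * real m" if "h \<in> {1, 2, 3}" for h
  proof -
    have "h \<le> graph_diameter G" using that diameter by auto
    then obtain u v where uv: "u \<in> pverts G" "v \<in> pverts G" "gdist G u v = h"
      by (rule ex_gdist_eq)
    then have "card (neighbours ?H u \<inter> neighbours ?H v) = m"
      using that gdist_eq_0_iff[of u v] by (intro m) (auto simp: distance_graph_def)
    then show ?thesis
      using common_neighbours_distance_graph[OF uv(1,2)] uv(3) by simp
  qed
  then show ?R by simp
next
  assume R: ?R
  have ccc: "real (c 2) * real (c 3) * real (c 4) \<noteq> 0"
    using array_pos by simp
  define N where "N u v = card (neighbours ?H u \<inter> neighbours ?H v)" for u v
  have N: "N u v = N u' v'" if "u \<in> pverts G" "v \<in> pverts G" "u' \<in> pverts G" "v' \<in> pverts G"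
    "p44 (gdist G u v) = p44 (gdist G u' v')" for u v u' v'
    using common_neighbours_distance_graph[OF that(1,2)]
      common_neighbours_distance_graph[OF that(3,4)] that(5) ccc
    unfolding N_def by (metis mult_cancel_left of_nat_eq_iff)
  obtain u0 where u0: "u0 \<in> pverts G" using pverts_nonempty by blast
  obtain u1 v1 where 1: "u1 \<in> pverts G" "v1 \<in> pverts G" "gdist G u1 v1 = 1"
    using ex_gdist_eq[of 1] diameter by auto
  obtain u4 v4 where 4: "u4 \<in> pverts G" "v4 \<in> pverts G" "gdist G u4 v4 = 4"
    using ex_gdist_eq[of 4] diameter by auto
  have reg: "card (neighbours ?H v) = N u0 u0" if "v \<in> pverts G" for v
    using N[of v v u0 u0] that u0 gdist_eq_0_iff[of v v] gdist_eq_0_iff[of u0 u0] unfolding N_def by simp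
  have adj: "N u v = N u4 v4" if "u \<in> pverts G" "v \<in> pverts G" "(u, v) \<in> parcs ?H" for u v
    using that 4 by (intro N) (auto simp: distance_graph_def)
  have nonadj: "N u v = N u1 v1"
    if "u \<in> pverts G" "v \<in> pverts G" "u \<noteq> v" "(u, v) \<notin> parcs ?H" for u v
  proof -
    have "gdist G u v \<in> {1, 2, 3}"
      using that gdist_cases[OF that(1,2)] gdist_eq_0_iff[OF that(1,2)]
      by (auto simp: distance_graph_def)
    then show ?thesis
      using that 1 R by (intro N) auto
  qed
  have "parcs ?H \<noteq> {}" "\<exists>u\<in>pverts ?H. \<exists>v\<in>pverts ?H. u \<noteq> v \<and> (u, v) \<notin> parcs ?H"
    using 1 4 gdist_eq_0_iff[of u1 v1] by (force simp: distance_graph_def)+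
  moreover have "\<forall>v\<in>pverts ?H. card (neighbours ?H v) = N u0 u0"
    "\<forall>u\<in>pverts ?H. \<forall>v\<in>pverts ?H. (u, v) \<in> parcs ?H \<longrightarrow>
      card (neighbours ?H u \<inter> neighbours ?H v) = N u4 v4"
    "\<forall>u\<in>pverts ?H. \<forall>v\<in>pverts ?H. u \<noteq> v \<and> (u, v) \<notin> parcs ?H \<longrightarrow>
      card (neighbours ?H u \<inter> neighbours ?H v) = N u1 v1"
    using reg adj nonadj unfolding N_def[symmetric] by (simp_all add: distance_graph_def)
  ultimately show "strongly_regular ?H"
    unfolding strongly_regular_def using pair_graph_distance_graph by blast
qed

lemma p44_eq_iff:
  "p44 1 = p44 2 \<and> p44 2 = p44 3 \<longleftrightarrow>
    real (b 3) = 1 + real (a 4) \<and> real (b 3) * real (c 3) = real (b 1)"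
  using array_condition_iff[OF array_sums array_pos(2,3,6) coeff_q_def coeff_r_def]
  unfolding p44_def by simp

section \<open>Antipodality in terms of common antipodes\<close>

lemma antipodal_imp_p44:
  assumes "antipodal G"
  shows "p44 1 = 0"
proof -
  obtain P where P: "partition_on (pverts G) P"
    "parcs (distance_graph G 4) = (\<Union>B\<in>P. {(u, v). u \<in> B \<and> v \<in> B \<and> u \<noteq> v})"
    using assms diameter
    unfolding antipodal_def disjoint_union_of_complete_graphs_def by (auto simp: distance_graph_def)
  obtain u v where uv: "u \<in> pverts G" "v \<in> pverts G" "gdist G u v = 1"
    using ex_gdist_eq[of 1] diameter by auto
  \<comment> \<open>A common antipode of the adjacent vertices \<open>u\<close> and \<open>v\<close>
    would put both into its block, hence at distance 4.\<close>
  have "{w \<in> pverts G. gdist G u w = 4 \<and> gdist G v w = 4} = {}"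
  proof (rule ccontr)
    assume "\<not> ?thesis"
    then obtain w where w: "w \<in> pverts G" "gdist G u w = 4" "gdist G v w = 4" by blast
    then have "(u, w) \<in> parcs (distance_graph G 4)" "(v, w) \<in> parcs (distance_graph G 4)"
      using uv by (auto simp: distance_graph_def)
    then obtain B C where "B \<in> P" "u \<in> B" "w \<in> B" "C \<in> P" "v \<in> C" "w \<in> C"
      unfolding P(2) by auto
    moreover have "u \<noteq> v" using uv gdist_eq_0_iff by force
    moreover have "disjoint P" using P(1) by (rule partition_onD2)
    ultimately have "(u, v) \<in> parcs (distance_graph G 4)"
      unfolding P(2) by (auto dest: disjointD)
    then show False using uv by (auto simp: distance_graph_def)
  qed
  then show ?thesis
    using common_antipodes[OF uv(1,2)] unfolding uv(3) by (simp only: card.empty of_nat_0 mult_zero_right)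
qed

text \<open>No two vertices at distance 1, 2 or 3 have a common antipode, so being equal or at
  distance 4 is transitive; its classes form the partition.\<close>

lemma p44_imp_antipodal:
  assumes "p44 1 = 0" "p44 2 = 0" "p44 3 = 0"
  shows "antipodal G"
proof -
  define R where "R = {(u, v). u \<in> pverts G \<and> v \<in> pverts G \<and> (u = v \<or> gdist G u v = 4)}"
  have "equiv (pverts G) R"
  proof (rule equivI)
    show "sym R" unfolding R_def sym_def using gdist_commute by auto
    show "trans R"
    proof (rule transI)
      fix u w v assume uw: "(u, w) \<in> R" and wv: "(w, v) \<in> R"
      then have V: "u \<in> pverts G" "w \<in> pverts G" "v \<in> pverts G" unfolding R_def by auto
      show "(u, v) \<in> R"
      proof (cases "u = w \<or> w = v \<or> u = v")
        case True
        then show ?thesis using uw wv unfolding R_def by auto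
      next
        case False
        then have "w \<in> {w \<in> pverts G. gdist G u w = 4 \<and> gdist G v w = 4}"
          using uw wv V gdist_commute unfolding R_def by auto
        then have "card {w \<in> pverts G. gdist G u w = 4 \<and> gdist G v w = 4} \<noteq> 0"
          using pair_finite_verts by (auto simp: card_eq_0_iff)
        then have "p44 (gdist G u v) \<noteq> 0"
          unfolding common_antipodes[OF V(1,3), symmetric] using array_pos by simp
        then have "gdist G u v = 4"
          using gdist_cases[OF V(1,3)] gdist_eq_0_iff[OF V(1,3)] False assms by auto
        then show ?thesis using V unfolding R_def by auto
      qed
    qed
  qed (auto simp: R_def refl_on_def)
  then have P: "partition_on (pverts G) (pverts G // R)" by (rule partition_on_quotient)
  have "(u, v) \<in> parcs (distance_graph G 4) \<longleftrightarrow> (u, v) \<in> R \<and> u \<noteq> v" for u v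
    unfolding distance_graph_def R_def using gdist_eq_0_iff by force
  moreover have "(u, v) \<in> R \<longleftrightarrow> (\<exists>B\<in>pverts G // R. u \<in> B \<and> v \<in> B)" for u v
  proof
    assume uv: "(u, v) \<in> R"
    then have "u \<in> pverts G" unfolding R_def by simp
    then show "\<exists>B\<in>pverts G // R. u \<in> B \<and> v \<in> B"
      using uv equiv_class_self[OF \<open>equiv (pverts G) R\<close>] by (auto intro!: quotientI bexI[of _ "R `` {u}"])
  next
    assume "\<exists>B\<in>pverts G // R. u \<in> B \<and> v \<in> B"
    then show "(u, v) \<in> R"
      using in_quotient_imp_in_rel[OF \<open>equiv (pverts G) R\<close>] by blast
  qed
  ultimately have "parcs (distance_graph G 4) =
      (\<Union>B\<in>pverts G // R. {(u, v). u \<in> B \<and> v \<in> B \<and> u \<noteq> v})"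
    by auto
  then show ?thesis
    using P diameter unfolding antipodal_def disjoint_union_of_complete_graphs_def
    by (auto simp: distance_graph_def)
qed

text \<open>Each distance matrix acts on an eigenfunction as a scalar. The recurrence for the fourth
  matrix and the vanishing total give the relations needed for
  \<open>eigenvalue_quartic\<close>.\<close>

lemma quartic_eigenvalue:
  assumes "\<theta> \<in> adjacency_eigenvalues G" "\<theta> \<noteq> real (b 0)"
  shows "quartic (real (a 1)) (real (b 1)) (real (c 2)) (real (a 2)) (real (b 3)) (real (c 3))
    (real (a 4)) (1 + \<theta>) = 0"
proof -
  obtain f u where f: "\<And>v. v \<in> pverts G \<Longrightarrow> dist_sum 1 f v = \<theta> * f v"
    and u: "u \<in> pverts G" "f u \<noteq> 0"
    using eigenfunction[OF assms(1)] by blast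
  \<comment> \<open>These scalars are forced: each recurrence is solved for its last term.\<close>
  define p2 where "p2 = (\<theta> * \<theta> - real (b 0) - real (a 1) * \<theta>) / real (c 2)"
  define p3 where "p3 = (\<theta> * p2 - real (a 2) * p2 - real (b 1) * \<theta>) / real (c 3)"
  define p4 where "p4 = (\<theta> * p3 - real (a 3) * p3 - real (b 2) * p2) / real (c 4)"
  have p: "real (c 2) * p2 = \<theta> * \<theta> - real (b 0) - real (a 1) * \<theta>"
    "real (c 3) * p3 = \<theta> * p2 - real (a 2) * p2 - real (b 1) * \<theta>"
    "real (c 4) * p4 = \<theta> * p3 - real (a 3) * p3 - real (b 2) * p2"
    unfolding p2_def p3_def p4_def using array_pos by simp_all
  have step: "dist_sum 1 g v = \<theta> * g v"
    if "\<forall>v\<in>pverts G. g v = x * f v" "v \<in> pverts G" for g x v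
  proof -
    have "dist_sum 1 g v = dist_sum 1 (\<lambda>v. x * f v) v"
      using that(1) by (intro dist_sum_cong) blast
    then show ?thesis using that f by (simp add: dist_sum_mult)
  qed
  have F1: "dist_sum 1 (dist_sum 1 f) v = \<theta> * dist_sum 1 f v" if "v \<in> pverts G" for v
    using f that by (intro step) auto
  have D2: "dist_sum 2 f v = p2 * f v" if v: "v \<in> pverts G" for v
  proof -
    have "real (c 2) * dist_sum 2 f v
        = dist_sum 1 (dist_sum 1 f) v - real (b 0) * f v - real (a 1) * dist_sum 1 f v"
      using dist_sum_rec_1[OF v, of f] by simp
    also have "\<dots> = real (c 2) * p2 * f v"
      unfolding F1[OF v] f[OF v] p by (simp add: algebra_simps)
    finally show ?thesis using array_pos(4) by simp
  qed
  have F2: "dist_sum 1 (dist_sum 2 f) v = \<theta> * dist_sum 2 f v" if "v \<in> pverts G" for v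
    using D2 that by (intro step) auto
  have D3: "dist_sum 3 f v = p3 * f v" if v: "v \<in> pverts G" for v
  proof -
    have "real (c 3) * dist_sum 3 f v
        = dist_sum 1 (dist_sum 2 f) v - real (b 1) * dist_sum 1 f v - real (a 2) * dist_sum 2 f v"
      using dist_sum_rec_2[OF v, of f] by simp
    also have "\<dots> = real (c 3) * p3 * f v"
      unfolding F2[OF v] D2[OF v] f[OF v] p by (simp add: algebra_simps)
    finally show ?thesis using array_pos(5) by simp
  qed
  have F3: "dist_sum 1 (dist_sum 3 f) v = \<theta> * dist_sum 3 f v" if "v \<in> pverts G" for v
    using D3 that by (intro step) auto
  have D4: "dist_sum 4 f v = p4 * f v" if v: "v \<in> pverts G" for v
  proof -
    have "real (c 4) * dist_sum 4 f v
        = dist_sum 1 (dist_sum 3 f) v - real (b 2) * dist_sum 2 f v - real (a 3) * dist_sum 3 f v"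
      using dist_sum_rec_3[OF v, of f] by simp
    also have "\<dots> = real (c 4) * p4 * f v"
      unfolding F3[OF v] D3[OF v] D2[OF v] p by (simp add: algebra_simps)
    finally show ?thesis using array_pos(6) by simp
  qed
  have F4: "dist_sum 1 (dist_sum 4 f) v = \<theta> * dist_sum 4 f v" if "v \<in> pverts G" for v
    using D4 that by (intro step) auto
  have "\<theta> * p4 * f u = (real (b 3) * p3 + real (a 4) * p4) * f u"
    using dist_sum_rec_4[OF u(1), of f] unfolding F4[OF u(1)] D3[OF u(1)] D4[OF u(1)]
    by (simp add: algebra_simps)
  then have e4: "\<theta> * p4 = real (b 3) * p3 + real (a 4) * p4"
    using u(2) by simp
  \<comment> \<open>Every vertex lies at exactly one distance from \<open>u\<close>, so the distance
    matrices add up to the all-one matrix.\<close>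
  have "dist_sum 0 f u + dist_sum 1 f u + dist_sum 2 f u + dist_sum 3 f u + dist_sum 4 f u
      = (\<Sum>v\<in>pverts G. f v)"
    unfolding dist_sum_def sum.distrib[symmetric]
  proof (rule sum.cong[OF refl])
    fix w assume w: "w \<in> pverts G"
    show "(if gdist G u w = 0 then f w else 0) + (if gdist G u w = 1 then f w else 0)
        + (if gdist G u w = 2 then f w else 0) + (if gdist G u w = 3 then f w else 0)
        + (if gdist G u w = 4 then f w else 0) = f w"
      using gdist_cases[OF u(1) w] by auto
  qed
  also have "\<dots> = 0"
    using f assms(2) by (rule sum_eigenfunction)
  finally have "f u * (1 + \<theta> + p2 + p3 + p4) = 0"
    unfolding dist_sum_0[OF u(1)] f[OF u(1)] D2[OF u(1)] D3[OF u(1)] D4[OF u(1)]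
    by (simp add: algebra_simps)
  then have "1 + \<theta> + p2 + p3 + p4 = 0" using u(2) by simp
  then show ?thesis
    using p(1,2) e4 by (intro eigenvalue_quartic[OF array_sums(1)]) simp_all
qed

end

theorem mainTheorem1:
  fixes G :: "'a pair_pre_digraph"
    and c a b :: "nat \<Rightarrow> nat"
    and n k :: nat
    and \<theta>0 \<theta>1 \<theta>2 \<theta>3 \<theta>4 :: real
  assumes "distance_regular G"
    and "card (pverts G) = n"
    and "graph_diameter G = 4"
    and "intersection_numbers G c a b"
    and "k = b 0"
    and "adjacency_eigenvalues G = {\<theta>0, \<theta>1, \<theta>2, \<theta>3, \<theta>4}"
    and "\<theta>0 = real k"
    and "\<theta>0 > \<theta>1" and "\<theta>1 > \<theta>2" and "\<theta>2 > \<theta>3" and "\<theta>3 > \<theta>4"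
  shows "(strongly_distance_regular G \<longleftrightarrow>
            (1 + \<theta>1) * (1 + \<theta>3) = (1 + \<theta>2) * (1 + \<theta>4) \<and>
            (1 + \<theta>2) * (1 + \<theta>4) = - real (b 1)) \<and>
         (strongly_distance_regular G \<longrightarrow>
            (antipodal G \<longleftrightarrow> \<theta>1 * \<theta>3 = - real k \<or> \<theta>1 + \<theta>3 = real (a 1)))"
proof -
  interpret pair_graph G
    using assms(1) unfolding distance_regular_def by blast
  interpret distance_regular_graph_4 G c a b
    using assms(1,3,4) unfolding distance_regular_def by unfold_locales auto
  let ?Q = "quartic (real (a 1)) (real (b 1)) (real (c 2)) (real (a 2)) (real (b 3)) (real (c 3))
    (real (a 4))"
  \<comment> \<open>These identities mediate: \<open>p44\<close> links them to strong regularity,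
    and the quartic to the eigenvalues.\<close>
  let ?D = "real (b 3) = 1 + real (a 4) \<and> real (b 3) * real (c 3) = real (b 1)"
  have ord: "1 + \<theta>1 > 1 + \<theta>2" "1 + \<theta>2 > 1 + \<theta>3" "1 + \<theta>3 > 1 + \<theta>4"
    using assms(9-11) by simp_all
  have "?Q (1 + \<theta>) = 0" if "\<theta> \<in> {\<theta>1, \<theta>2, \<theta>3, \<theta>4}" for \<theta>
    using that assms(5-11) by (intro quartic_eigenvalue) auto
  then have Q: "?Q y = 0" if "y \<in> {1 + \<theta>1, 1 + \<theta>2, 1 + \<theta>3, 1 + \<theta>4}" for y
    using that by auto
  have sums: "1 + real (a 1) + real (b 1) = real (c 2) + real (a 2) + real (b 2)"
    using array_sums by simp
  have SDR: "strongly_distance_regular G \<longleftrightarrow> ?D"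
    using assms(1,3) strongly_regular_distance_graph_iff p44_eq_iff
    unfolding strongly_distance_regular_def by simp
  have paired: "(1 + \<theta>1) * (1 + \<theta>3) = - real (b 1) \<and> (1 + \<theta>2) * (1 + \<theta>4) = - real (b 1)" if ?D
    using quartic_roots_paired[OF _ _ array_pos(1) ord Q] that by blast
  moreover have ?D
    if "(1 + \<theta>1) * (1 + \<theta>3) = - real (b 1)" "(1 + \<theta>2) * (1 + \<theta>4) = - real (b 1)"
    using quartic_paired_roots_imp[OF sums array_pos(1,2,4) ord Q that] by blast
  moreover have "antipodal G \<longleftrightarrow> \<theta>1 * \<theta>3 = - real k \<or> \<theta>1 + \<theta>3 = real (a 1)" if D: ?D
  proof -
    \<comment> \<open>Since the three coefficients coincide, the vanishing of one gives all three
      hypotheses of \<open>p44_imp_antipodal\<close>.\<close>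
    have "p44 1 = p44 2" "p44 2 = p44 3" using D p44_eq_iff by blast+
    then have "antipodal G \<longleftrightarrow> p44 1 = 0"
      using antipodal_imp_p44 p44_imp_antipodal by metis
    also have "\<dots> \<longleftrightarrow> real (a 4) = 0"
      using array_pos unfolding p44_def by simp
    also have "\<dots> \<longleftrightarrow> (1 + \<theta>1) + (1 + \<theta>3) = real (a 1) + 2"
      using a4_eq_0_iff_root_sum[OF _ _ array_pos(1) sums array_pos(2,4) ord Q] D by blast
    also have "\<dots> \<longleftrightarrow> \<theta>1 + \<theta>3 = real (a 1)" by auto
    also have "\<dots> \<longleftrightarrow> \<theta>1 * \<theta>3 = - real k \<or> \<theta>1 + \<theta>3 = real (a 1)"
    proof -
      \<comment> \<open>Expanding \<open>(1 + \<theta>1) * (1 + \<theta>3) = - b1\<close> with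
        \<open>k = 1 + a1 + b1\<close> gives
        \<open>\<theta>1 * \<theta>3 + \<theta>1 + \<theta>3 = a1 - k\<close>, so the two
        alternatives are equivalent.\<close>
      have "\<theta>1 * \<theta>3 = - real k \<longleftrightarrow> \<theta>1 + \<theta>3 = real (a 1)"
        using paired[OF D] array_sums(1) assms(5) by (auto simp: algebra_simps)
      then show ?thesis by blast
    qed
    finally show ?thesis .
  qed
  ultimately show ?thesis
    unfolding SDR by argo
qed

end
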